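(* Let $\Omega\subset\mathbb{R}^n$ be an open set, let $0<\alpha<n$, and let $p:\Omega\to[1,\infty)$ be a measurable function such that $$1<\inf_{x\in\Omega}p(x)\le p(x)\le \sup_{x\in\Omega}p(x)<\frac{n}{\alpha}.$$ Let $q$ be defined on $\Omega$ by $\frac{1}{q(x)}=\frac{1}{p(x)}-\frac{\alpha}{n}$. Suppose that the Hardy–Littlewood maximal operator $M$ is bounded on $L^{s(\cdot)}(\Omega)$, where $s(x)=q(x)\left(1-\frac{\alpha}{n}\right)$; that is, there is a constant $C_0$ with $\|Mg\|_{s(\cdot),\Omega}\le C_0\|g\|_{s(\cdot),\Omega}$ for all $g\in L^{s(\cdot)}(\Omega)$. Then the fractional maximal operator $M_\alpha$ is bounded from $L^{p(\cdot)}(\Omega)$ to $L^{q(\cdot)}(\Omega)$: there is a constant $C$ such that $$\|M_\alpha f\|_{q(\cdot),\Omega}\le C\,\|f\|_{p(\cdot),\Omega}\qquad\text{for all } f\in L^{p(\cdot)}(\Omega).$$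
   Context: For a measurable function $r:\Omega\to[1,\infty)$, the variable exponent Lebesgue space $L^{r(\cdot)}(\Omega)$ consists of all measurable functions $f$ on $\Omega$ such that $\int_{\Omega}\left(|f(x)|/\lambda\right)^{r(x)}\,dx<\infty$ for some $\lambda>0$, with norm $$\|f\|_{r(\cdot),\Omega}=\inf\left\{\lambda>0:\int_{\Omega}\left(|f(x)|/\lambda\right)^{r(x)}\,dx\le 1\right\}.$$ For $0\le\alpha<n$ and a measurable function $f$ on $\Omega$, the fractional maximal operator is $$M_{\alpha}f(x)=\sup_{B\ni x}\frac{1}{|B|^{1-\alpha/n}}\int_{B\cap\Omega}|f(y)|\,dy,\qquad x\in\Omega,$$ where the supremum is taken over all balls $B\subset\mathbb{R}^n$ containing $x$ and $|B|$ is Lebesgue measure. When $\alpha=0$, $M=M_0$ is the Hardy–Littlewood maximal operator. *)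

theory Defs
  imports "HOL-Analysis.Analysis"
begin

text \<open>
  Functions in the variable exponent spaces are real valued and matter only on \<open>\<Omega>\<close>; measurable
  means Lebesgue measurable. Maximal functions may take the value \<open>\<infinity>\<close>, so the modular and the
  norm are defined for \<open>ennreal\<close>-valued functions, to be applied to \<open>\<lambda>x. ennreal \<bar>f x\<bar>\<close>
  for real-valued \<open>f\<close>.
\<close>

text \<open>The exponents below are positive, so \<open>\<infinity>\<close> to the power \<open>r\<close> is \<open>\<infinity>\<close>
  and \<open>0\<close> to the power \<open>r\<close> is \<open>0\<close>.\<close>

definition ennreal_powr :: "ennreal \<Rightarrow> real \<Rightarrow> ennreal" where
  "ennreal_powr a r = (if a = \<infinity> then \<infinity> else ennreal (enn2real a powr r))"

definition var_modular ::
    "(real ^ 'n::finite) set \<Rightarrow> (real ^ 'n \<Rightarrow> real) \<Rightarrow> (real ^ 'n \<Rightarrow> ennreal) \<Rightarrow> ennreal" where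
  "var_modular \<Omega> r F = (\<integral>\<^sup>+ x\<in>\<Omega>. ennreal_powr (F x) (r x) \<partial>lebesgue)"

text \<open>The infimum is taken in \<open>ennreal\<close>, so it is \<open>\<infinity>\<close> when no \<open>l\<close> is admissible.
  For exponents \<open>r \<ge> 1\<close> a finite norm is equivalent to the modular of \<open>F / l\<close> being
  finite for some \<open>l\<close>; see \<open>var_norm_finite_iff\<close>.\<close>

definition var_norm ::
    "(real ^ 'n::finite) set \<Rightarrow> (real ^ 'n \<Rightarrow> real) \<Rightarrow> (real ^ 'n \<Rightarrow> ennreal) \<Rightarrow> ennreal" where
  "var_norm \<Omega> r F =
     Inf {ennreal l | l. 0 < l \<and> var_modular \<Omega> r (\<lambda>x. F x / ennreal l) \<le> 1}"

definition var_lebesgue ::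
    "(real ^ 'n::finite) set \<Rightarrow> (real ^ 'n \<Rightarrow> real) \<Rightarrow> (real ^ 'n \<Rightarrow> real) set" where
  "var_lebesgue \<Omega> r =
     {f. f \<in> borel_measurable (lebesgue_on \<Omega>) \<and>
         (\<exists>l>0. var_modular \<Omega> r (\<lambda>x. ennreal \<bar>f x\<bar> / ennreal l) < \<infinity>)}"

definition frac_maximal ::
    "real \<Rightarrow> (real ^ 'n::finite) set \<Rightarrow> (real ^ 'n \<Rightarrow> real) \<Rightarrow> real ^ 'n \<Rightarrow> ennreal" where
  "frac_maximal \<alpha> \<Omega> f x =
     (SUP B \<in> {ball c \<rho> | c \<rho>. 0 < \<rho> \<and> x \<in> ball c \<rho>}.
        (\<integral>\<^sup>+ y\<in>B \<inter> \<Omega>. ennreal \<bar>f y\<bar> \<partial>lebesgue)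
          / ennreal (measure lebesgue B powr (1 - \<alpha> / real CARD('n))))"

abbreviation hl_maximal ::
    "(real ^ 'n::finite) set \<Rightarrow> (real ^ 'n \<Rightarrow> real) \<Rightarrow> real ^ 'n \<Rightarrow> ennreal" where
  "hl_maximal \<equiv> frac_maximal 0"

lemma ennreal_powr_scale:
  assumes "1 \<le> r" "1 \<le> t" "0 < l"
  shows "ennreal_powr (a / ennreal (l * t)) r \<le> ennreal_powr (a / ennreal l) r * ennreal (1 / t)"
proof (cases a)
  case (real b)
  have *: "(b / (l * t)) powr r \<le> (b / l) powr r * (1 / t)"
  proof -
    have "(b / (l * t)) powr r = (b / l) powr r * (1 / t) powr r"
      using assms real by (simp add: powr_mult [symmetric] divide_simps)
    moreover have "(1 / t) powr r \<le> (1 / t) powr 1"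
      using assms by (intro powr_mono') auto
    ultimately show ?thesis
      using mult_left_mono[of "(1 / t) powr r" "1 / t" "(b / l) powr r"] assms by simp
  qed
  have 1: "a / ennreal (l * t) = ennreal (b / (l * t))" "a / ennreal l = ennreal (b / l)"
    using assms real by (simp_all add: divide_ennreal)
  show ?thesis
    unfolding 1 ennreal_powr_def using assms real * by (simp add: ennreal_mult' [symmetric])
next
  case top
  then show ?thesis
    using assms by (simp add: ennreal_powr_def ennreal_top_divide ennreal_top_mult)
qed

lemma ennreal_powr_measurable [measurable]:
  assumes [measurable]: "F \<in> borel_measurable M" "r \<in> borel_measurable M"
  shows "(\<lambda>x. ennreal_powr (F x) (r x)) \<in> borel_measurable M"
  unfolding ennreal_powr_def by measurable

lemma var_norm_finite_iff:
  fixes \<Omega> :: "(real ^ 'n::finite) set"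
  assumes "\<Omega> \<in> sets lebesgue"
    and r: "\<And>x. x \<in> \<Omega> \<Longrightarrow> 1 \<le> r x" "r \<in> borel_measurable (lebesgue_on \<Omega>)"
    and F: "F \<in> borel_measurable (lebesgue_on \<Omega>)"
  shows "var_norm \<Omega> r F < \<infinity> \<longleftrightarrow> (\<exists>l>0. var_modular \<Omega> r (\<lambda>x. F x / ennreal l) < \<infinity>)"
proof
  assume "var_norm \<Omega> r F < \<infinity>"
  then have "{ennreal l | l. 0 < l \<and> var_modular \<Omega> r (\<lambda>x. F x / ennreal l) \<le> 1} \<noteq> {}"
    unfolding var_norm_def by (metis Inf_empty infinity_ennreal_def less_irrefl)
  then obtain l where "0 < l" "var_modular \<Omega> r (\<lambda>x. F x / ennreal l) \<le> 1" by auto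
  then show "\<exists>l>0. var_modular \<Omega> r (\<lambda>x. F x / ennreal l) < \<infinity>"
    using le_less_trans[OF _ ennreal_one_less_top] by auto
next
  assume "\<exists>l>0. var_modular \<Omega> r (\<lambda>x. F x / ennreal l) < \<infinity>"
  then obtain l where l: "0 < l" "var_modular \<Omega> r (\<lambda>x. F x / ennreal l) < \<infinity>" by blast
  define m where "m = enn2real (var_modular \<Omega> r (\<lambda>x. F x / ennreal l))"
  have m: "var_modular \<Omega> r (\<lambda>x. F x / ennreal l) = ennreal m"
    using l by (simp add: m_def)
  have m0: "0 \<le> m" by (simp add: m_def)
  define t where "t = max 1 m"
  have t: "1 \<le> t" "m \<le> t" by (auto simp: t_def)
  have mod: "var_modular \<Omega> r G = (\<integral>\<^sup>+ x. ennreal_powr (G x) (r x) \<partial>lebesgue_on \<Omega>)" for G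
    unfolding var_modular_def using assms(1) by (simp add: nn_integral_restrict_space)
  have "var_modular \<Omega> r (\<lambda>x. F x / ennreal (l * t))
      \<le> (\<integral>\<^sup>+ x. ennreal_powr (F x / ennreal l) (r x) * ennreal (1 / t) \<partial>lebesgue_on \<Omega>)"
    unfolding mod using r l t by (intro nn_integral_mono ennreal_powr_scale) auto
  also have "\<dots> = var_modular \<Omega> r (\<lambda>x. F x / ennreal l) * ennreal (1 / t)"
    unfolding mod using r F
    by (intro nn_integral_multc ennreal_powr_measurable borel_measurable_divide_ennreal
          borel_measurable_const) auto
  also have "\<dots> \<le> 1"
    unfolding m using m0 t by (simp add: ennreal_mult [symmetric])
  finally have "var_norm \<Omega> r F \<le> ennreal (l * t)"
    unfolding var_norm_def using l t by (intro Inf_lower) auto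
  then show "var_norm \<Omega> r F < \<infinity>"
    using ennreal_less_top le_less_trans infinity_ennreal_def by metis
qed

end

theory Submission
  imports Defs
begin

text \<open>
  Let \<open>\<theta> = 1 - \<alpha> / n\<close> and suppose that the modular of \<open>h \<ge> 0\<close> is at most \<open>1\<close>. Since
  \<open>1 = p / q + p \<alpha> / n\<close> and \<open>s = q \<theta>\<close>, we have
  \<open>h = u powr \<theta> * v powr (1 - \<theta>)\<close> with \<open>u = h powr (p / s)\<close> and \<open>v = h powr p\<close>. Hoelder's inequality with exponents \<open>1 / \<theta>\<close> and \<open>n / \<alpha>\<close> on each ball gives
  the pointwise bound \<open>M\<^sub>\<alpha> h \<le> (M u)\<^sup>\<theta>\<close>. The modulars of \<open>u\<close> for \<open>s\<close> and of \<open>h\<close> for \<open>p\<close> agree,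
  as do those of \<open>(M u)\<^sup>\<theta>\<close> for \<open>q\<close> and of \<open>M u\<close> for \<open>s\<close>, so boundedness of \<open>M\<close> transfers to \<open>M\<^sub>\<alpha>\<close>.
\<close>

section \<open>Powers, modulars and norms of extended nonnegative functions, and a normalised
  Hoelder inequality\<close>

lemma ennreal_powr_ennreal [simp]: "0 \<le> a \<Longrightarrow> ennreal_powr (ennreal a) r = ennreal (a powr r)"
  by (simp add: ennreal_powr_def)

lemma ennreal_powr_mono: "a \<le> b \<Longrightarrow> 0 \<le> r \<Longrightarrow> ennreal_powr a r \<le> ennreal_powr b r"
  by (cases a; cases b) (auto simp: ennreal_powr_def top_unique intro!: ennreal_leI powr_mono2)

lemma ennreal_powr_powr: "ennreal_powr (ennreal_powr a r) t = ennreal_powr a (r * t)"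
  by (cases a) (auto simp: ennreal_powr_def powr_powr)

lemma ennreal_powr_divide:
  assumes "0 < c"
  shows "ennreal_powr (a / ennreal c) r = ennreal_powr a r / ennreal (c powr r)"
  using assms
  by (cases a) (auto simp: ennreal_powr_def divide_ennreal powr_divide ennreal_top_divide)

lemma var_modular_mono:
  assumes "\<And>x. x \<in> \<Omega> \<Longrightarrow> ennreal_powr (F x) (r x) \<le> ennreal_powr (G x) (t x)"
  shows "var_modular \<Omega> r F \<le> var_modular \<Omega> t G"
  unfolding var_modular_def using assms
  by (intro nn_integral_mono) (auto split: split_indicator)

text \<open>A strict inequality avoids asking whether the infimum is attained: it yields an
  admissible \<open>l < c\<close>, and enlarging the divisor only lowers the modular when the
  exponents are nonnegative.\<close>

lemma var_norm_less_imp_modular_le_1: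
  fixes c :: real
  assumes "var_norm \<Omega> r F < ennreal c" and "\<And>x. x \<in> \<Omega> \<Longrightarrow> 0 \<le> r x"
  shows "var_modular \<Omega> r (\<lambda>x. F x / ennreal c) \<le> 1"
proof -
  obtain l where l: "0 < l" "var_modular \<Omega> r (\<lambda>x. F x / ennreal l) \<le> 1" "ennreal l < ennreal c"
    using assms(1) unfolding var_norm_def Inf_less_iff by auto
  have "F x / ennreal c \<le> F x / ennreal l" for x
    using l(1,3) by (cases "F x") (auto simp: ennreal_less_iff divide_ennreal ennreal_top_divide
        intro!: ennreal_leI divide_left_mono)
  then have "var_modular \<Omega> r (\<lambda>x. F x / ennreal c) \<le> var_modular \<Omega> r (\<lambda>x. F x / ennreal l)"
    using assms(2) by (intro var_modular_mono ennreal_powr_mono) auto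
  with l(2) show ?thesis by simp
qed

lemma var_norm_le:
  assumes "0 < l" "var_modular \<Omega> r (\<lambda>x. F x / ennreal l) \<le> 1"
  shows "var_norm \<Omega> r F \<le> ennreal l"
  unfolding var_norm_def using assms by (intro Inf_lower) auto

text \<open>Hoelder's inequality with exponents \<open>1 / \<theta>\<close> and
  \<open>1 / (1 - \<theta>)\<close>, normalised so that \<open>v\<close> contributes at most 1. It
  follows by integrating the weighted Young inequality for \<open>u x / a\<close> and
  \<open>v x\<close>, scaled by \<open>a powr \<theta>\<close>.\<close>

lemma nn_integral_powr_mult_le:
  fixes u v :: "'a \<Rightarrow> real"
  assumes [measurable]: "u \<in> borel_measurable M" "v \<in> borel_measurable M"
    and nonneg: "\<And>x. 0 \<le> u x" "\<And>x. 0 \<le> v x"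
    and \<theta>: "0 < \<theta>" "\<theta> < 1" and "0 < a"
    and u: "(\<integral>\<^sup>+ x. ennreal (u x) \<partial>M) \<le> ennreal a"
    and v: "(\<integral>\<^sup>+ x. ennreal (v x) \<partial>M) \<le> 1"
  shows "(\<integral>\<^sup>+ x. ennreal (u x powr \<theta> * v x powr (1 - \<theta>)) \<partial>M) \<le> ennreal (a powr \<theta>)"
proof -
  \<comment> \<open>The coefficients of Young's inequality after scaling; \<open>A * a + B\<close>
    collapses to \<open>a powr \<theta>\<close> because the weights \<open>\<theta>\<close> and
    \<open>1 - \<theta>\<close> add up to 1.\<close>
  define A B where "A = a powr \<theta> * \<theta> / a" and "B = a powr \<theta> * (1 - \<theta>)"
  have AB: "0 \<le> A" "0 \<le> B" using \<theta> \<open>0 < a\<close> by (auto simp: A_def B_def)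
  have *: "u x powr \<theta> * v x powr (1 - \<theta>) \<le> A * u x + B * v x" for x
  \<comment> \<open>If either value is 0 the product vanishes, since \<open>0 powr r = 0\<close>;
    Young's inequality is applied to positive values only.\<close>
  proof (cases "u x = 0 \<or> v x = 0")
    case True
    then show ?thesis using nonneg AB by auto
  next
    case False
    then have pos: "0 < u x" "0 < v x" using nonneg[of x] by linarith+
    have "u x powr \<theta> * v x powr (1 - \<theta>) = a powr \<theta> * ((u x / a) powr \<theta> * v x powr (1 - \<theta>))"
      using pos \<open>0 < a\<close> by (simp add: powr_divide)
    also have "\<dots> \<le> a powr \<theta> * (\<theta> * (u x / a) + (1 - \<theta>) * v x)"
      using pos \<open>0 < a\<close> \<theta> by (intro mult_left_mono Youngs_inequality_0) auto
    also have "\<dots> = A * u x + B * v x"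
      by (simp add: A_def B_def algebra_simps)
    finally show ?thesis .
  qed
  have "(\<integral>\<^sup>+ x. ennreal (u x powr \<theta> * v x powr (1 - \<theta>)) \<partial>M)
      \<le> (\<integral>\<^sup>+ x. ennreal A * ennreal (u x) + ennreal B * ennreal (v x) \<partial>M)"
    using * AB nonneg
    by (intro nn_integral_mono)
      (simp add: ennreal_mult [symmetric] ennreal_plus [symmetric] del: ennreal_plus)
  also have "\<dots> = ennreal A * (\<integral>\<^sup>+ x. ennreal (u x) \<partial>M) + ennreal B * (\<integral>\<^sup>+ x. ennreal (v x) \<partial>M)"
    by (simp add: nn_integral_add nn_integral_cmult)
  also have "\<dots> \<le> ennreal A * ennreal a + ennreal B * 1"
    by (intro add_mono mult_left_mono u v) auto
  also have "\<dots> = ennreal (A * a + B)"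
    using AB \<open>0 < a\<close> by (simp add: ennreal_mult [symmetric] ennreal_plus [symmetric] del: ennreal_plus)
  also have "A * a + B = a powr \<theta>"
    using \<open>0 < a\<close> by (simp add: A_def B_def algebra_simps)
  finally show ?thesis .
qed

section \<open>Pointwise comparison of the two maximal operators\<close>

lemma nn_integral_Int_lebesgue:
  assumes "B \<in> sets lebesgue" "\<Omega> \<in> sets lebesgue"
  shows "(\<integral>\<^sup>+ y\<in>B \<inter> \<Omega>. f y \<partial>lebesgue) = (\<integral>\<^sup>+ y. f y \<partial>lebesgue_on (B \<inter> \<Omega>))"
  using assms by (intro nn_integral_restrict_space [symmetric]) auto

lemma measurable_Int_lebesgue:
  assumes "f \<in> borel_measurable (lebesgue_on \<Omega>)"
  shows "f \<in> borel_measurable (lebesgue_on (B \<inter> \<Omega>))"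
  using assms by (rule measurable_restrict_mono) auto

text \<open>On a ball of measure \<open>b\<close>, Hoelder bounds the integral of |h| by that of
  \<open>u\<close> to the power \<theta> = 1 - \<alpha> / n, as \<open>v\<close> has integral at
  most 1. The normalisation in \<open>frac_maximal\<close> is exactly
  \<open>b powr \<theta>\<close>, so the quotient is at most the average of \<open>u\<close> to the
  power \<theta>.\<close>

lemma frac_maximal_le_hl_maximal_powr:
  fixes \<Omega> :: "(real ^ 'n::finite) set"
  defines "n \<equiv> real CARD('n)"
  assumes \<Omega>: "\<Omega> \<in> sets lebesgue" and \<alpha>: "0 < \<alpha>" "\<alpha> < n"
    and meas: "u \<in> borel_measurable (lebesgue_on \<Omega>)" "v \<in> borel_measurable (lebesgue_on \<Omega>)"
    and nonneg: "\<And>x. 0 \<le> u x" "\<And>x. 0 \<le> v x"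
    and h: "\<And>y. y \<in> \<Omega> \<Longrightarrow> \<bar>h y\<bar> = u y powr (1 - \<alpha> / n) * v y powr (\<alpha> / n)"
    and v: "(\<integral>\<^sup>+ y\<in>\<Omega>. ennreal (v y) \<partial>lebesgue) \<le> 1"
  shows "frac_maximal \<alpha> \<Omega> h x \<le> ennreal_powr (hl_maximal \<Omega> u x) (1 - \<alpha> / n)"
proof -
  define \<theta> where "\<theta> = 1 - \<alpha> / n"
  have \<theta>: "0 < \<theta>" "\<theta> < 1" "1 - \<theta> = \<alpha> / n" using \<alpha> by (auto simp: \<theta>_def)
  \<comment> \<open>Restricted to positive real bounds \<open>m\<close>, since the Hoelder lemma is
    applied with \<open>a = m * b > 0\<close>; the values 0 and infinity of the maximal function of
    \<open>u\<close> are treated afterwards.\<close>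
  have bound: "frac_maximal \<alpha> \<Omega> h x \<le> ennreal (m powr \<theta>)"
    if m: "0 < m" "hl_maximal \<Omega> u x \<le> ennreal m" for m
    unfolding frac_maximal_def
  proof (rule SUP_least)
    fix B assume B: "B \<in> {ball c \<rho> |c \<rho>. 0 < \<rho> \<and> x \<in> ball c \<rho>}"
    define b where "b = measure lebesgue B"
    have Bl: "B \<in> sets lebesgue" using B by auto
    have b: "0 < b" using B by (auto simp: b_def content_ball_pos)
    have "(\<integral>\<^sup>+ y\<in>B \<inter> \<Omega>. ennreal \<bar>u y\<bar> \<partial>lebesgue) / ennreal (measure lebesgue B powr (1 - 0 / n))
        \<le> hl_maximal \<Omega> u x"
      unfolding frac_maximal_def n_def using B by (rule SUP_upper)
    then have "(\<integral>\<^sup>+ y. ennreal (u y) \<partial>lebesgue_on (B \<inter> \<Omega>)) / ennreal b \<le> ennreal m"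
      using m(2) b nonneg by (simp add: nn_integral_Int_lebesgue[OF Bl \<Omega>] b_def)
    then have "(\<integral>\<^sup>+ y. ennreal (u y) \<partial>lebesgue_on (B \<inter> \<Omega>)) / ennreal b * ennreal b
        \<le> ennreal m * ennreal b"
      by (intro mult_right_mono) auto
    then have ub: "(\<integral>\<^sup>+ y. ennreal (u y) \<partial>lebesgue_on (B \<inter> \<Omega>)) \<le> ennreal (m * b)"
      using b m by (simp add: ennreal_divide_times ennreal_mult)
    have "(\<integral>\<^sup>+ y\<in>B \<inter> \<Omega>. ennreal (v y) \<partial>lebesgue) \<le> (\<integral>\<^sup>+ y\<in>\<Omega>. ennreal (v y) \<partial>lebesgue)"
      by (intro nn_integral_mono) (auto split: split_indicator)
    then have vb: "(\<integral>\<^sup>+ y. ennreal (v y) \<partial>lebesgue_on (B \<inter> \<Omega>)) \<le> 1"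
      using v by (simp add: nn_integral_Int_lebesgue[OF Bl \<Omega>])
    have "(\<integral>\<^sup>+ y\<in>B \<inter> \<Omega>. ennreal \<bar>h y\<bar> \<partial>lebesgue)
        = (\<integral>\<^sup>+ y. ennreal (u y powr \<theta> * v y powr (1 - \<theta>)) \<partial>lebesgue_on (B \<inter> \<Omega>))"
      unfolding nn_integral_Int_lebesgue[OF Bl \<Omega>] using h \<theta>
      by (intro nn_integral_cong) (auto simp: \<theta>_def)
    also have "\<dots> \<le> ennreal ((m * b) powr \<theta>)"
      using m b \<theta> ub vb nonneg meas
      by (intro nn_integral_powr_mult_le measurable_Int_lebesgue) auto
    finally have "(\<integral>\<^sup>+ y\<in>B \<inter> \<Omega>. ennreal \<bar>h y\<bar> \<partial>lebesgue) \<le> ennreal (b powr \<theta>) * ennreal (m powr \<theta>)"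
      using m b by (simp add: powr_mult ennreal_mult' mult.commute)
    then show "(\<integral>\<^sup>+ y\<in>B \<inter> \<Omega>. ennreal \<bar>h y\<bar> \<partial>lebesgue)
        / ennreal (measure lebesgue B powr (1 - \<alpha> / real CARD('n))) \<le> ennreal (m powr \<theta>)"
      using b by (intro divide_le_posI_ennreal) (auto simp: b_def \<theta>_def n_def)
  qed
  show ?thesis
  proof (cases "hl_maximal \<Omega> u x")
    case (real m)
    show ?thesis
    proof (cases "m = 0")
      case True
      \<comment> \<open>Each \<open>e powr (1 / \<theta>)\<close> is a positive upper bound for the
        value 0, and its power \<theta> is \<open>e\<close>.\<close>
      have "frac_maximal \<alpha> \<Omega> h x \<le> ennreal e" if "0 < e" for e
        using bound[of "e powr (1 / \<theta>)"] that \<theta> real True by (simp add: powr_powr)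
      then have "frac_maximal \<alpha> \<Omega> h x \<le> 0"
        by (auto intro: ennreal_le_epsilon [where y = 0, simplified])
      then show ?thesis by simp
    next
      case False
      then show ?thesis using bound[of m] real by (simp add: \<theta>_def)
    qed
  qed (simp add: ennreal_powr_def)
qed

text \<open>Homogeneity, used to pass from \<open>f\<close> to \<open>f / l\<close> with modular at
  most 1. The factor leaves the integral on each ball and then the supremum.\<close>

lemma frac_maximal_divide:
  assumes \<Omega>: "\<Omega> \<in> sets lebesgue" and f: "f \<in> borel_measurable (lebesgue_on \<Omega>)" and l: "0 < l"
  shows "frac_maximal \<alpha> \<Omega> (\<lambda>y. f y / l) x = frac_maximal \<alpha> \<Omega> f x / ennreal l"
proof -
  have "(\<integral>\<^sup>+ y\<in>B \<inter> \<Omega>. ennreal \<bar>f y / l\<bar> \<partial>lebesgue) / c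
      = (\<integral>\<^sup>+ y\<in>B \<inter> \<Omega>. ennreal \<bar>f y\<bar> \<partial>lebesgue) / c / ennreal l"
    if B: "B \<in> {ball c \<rho> |c \<rho>. 0 < \<rho> \<and> x \<in> ball c \<rho>}" for B c
  proof -
    have Bl: "B \<in> sets lebesgue" using B by auto
    note [measurable] = measurable_Int_lebesgue[OF f, of B]
    have "(\<integral>\<^sup>+ y. ennreal \<bar>f y / l\<bar> \<partial>lebesgue_on (B \<inter> \<Omega>))
        = (\<integral>\<^sup>+ y. ennreal \<bar>f y\<bar> / ennreal l \<partial>lebesgue_on (B \<inter> \<Omega>))"
      using l by (simp add: divide_ennreal)
    also have "\<dots> = (\<integral>\<^sup>+ y. ennreal \<bar>f y\<bar> \<partial>lebesgue_on (B \<inter> \<Omega>)) / ennreal l"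
      by (intro nn_integral_divide) measurable
    finally show ?thesis
      unfolding nn_integral_Int_lebesgue[OF Bl \<Omega>] by (simp add: divide_ennreal_def mult_ac)
  qed
  then show ?thesis
    unfolding frac_maximal_def SUP_divide_ennreal by (intro SUP_cong) auto
qed

section \<open>Transfer of the norm bound\<close>

theorem mainTheorem2:
  fixes \<Omega> :: "(real ^ 'n::finite) set" and \<alpha> :: real and p q s :: "real ^ 'n \<Rightarrow> real"
  assumes "open \<Omega>"
    and "0 < \<alpha>" and "\<alpha> < real CARD('n)"
    and "p \<in> borel_measurable (lebesgue_on \<Omega>)"
    and "\<And>x. x \<in> \<Omega> \<Longrightarrow> 1 \<le> p x"
    and "1 < (INF x\<in>\<Omega>. ereal (p x))"
    and "(SUP x\<in>\<Omega>. ereal (p x)) < ereal (real CARD('n) / \<alpha>)"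
    and "\<And>x. x \<in> \<Omega> \<Longrightarrow> 1 / q x = 1 / p x - \<alpha> / real CARD('n)"
    and "s = (\<lambda>x. q x * (1 - \<alpha> / real CARD('n)))"
    and "\<exists>C\<^sub>0\<ge>0. \<forall>g\<in>var_lebesgue \<Omega> s.
           var_norm \<Omega> s (hl_maximal \<Omega> g) \<le> ennreal C\<^sub>0 * var_norm \<Omega> s (\<lambda>x. ennreal \<bar>g x\<bar>)"
  shows "\<exists>C\<ge>0. \<forall>f\<in>var_lebesgue \<Omega> p.
           var_norm \<Omega> q (frac_maximal \<alpha> \<Omega> f) \<le> ennreal C * var_norm \<Omega> p (\<lambda>x. ennreal \<bar>f x\<bar>)"
proof -
  define n where "n = real CARD('n)"
  define \<theta> where "\<theta> = 1 - \<alpha> / n"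
  have \<alpha>: "0 < \<alpha>" "\<alpha> < n" using assms(2,3) by (auto simp: n_def)
  have \<theta>: "0 < \<theta>" "\<theta> < 1" "1 - \<theta> = \<alpha> / n" using \<alpha> by (auto simp: \<theta>_def)
  have \<Omega>: "\<Omega> \<in> sets lebesgue" using assms(1) by simp
  have p1: "1 \<le> p x" if "x \<in> \<Omega>" for x using assms(5) that .
  have q_eq: "1 / q x = 1 / p x - \<alpha> / n" if "x \<in> \<Omega>" for x
    using assms(8)[OF that] by (simp add: n_def)
  have p_less: "p x < n / \<alpha>" if "x \<in> \<Omega>" for x
    using le_less_trans[OF SUP_upper[OF that] assms(7)] by (simp add: n_def)
  \<comment> \<open>The strict bound \<open>p x < n / \<alpha>\<close> makes
    \<open>1 / p x - \<alpha> / n\<close> positive.\<close>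
  have q_pos: "0 < q x" if "x \<in> \<Omega>" for x
  proof -
    have "\<alpha> / n < 1 / p x" using p_less[OF that] p1[OF that] \<alpha> by (simp add: field_simps)
    then have "0 < 1 / q x" using q_eq[OF that] by simp
    then show ?thesis by simp
  qed
  have s_eq: "s x = q x * \<theta>" for x using assms(9) by (simp add: \<theta>_def n_def)
  have s_pos: "0 < s x" if "x \<in> \<Omega>" for x using q_pos[OF that] \<theta> by (simp add: s_eq)
  have [measurable]: "p \<in> borel_measurable (lebesgue_on \<Omega>)" by fact
  \<comment> \<open>Measurability is inherited from \<open>p\<close> by solving the relation between
    the exponents for \<open>q\<close> on \<Omega>.\<close>
  have [measurable]: "s \<in> borel_measurable (lebesgue_on \<Omega>)"
  proof -
    have "s x = \<theta> / (1 / p x - \<alpha> / n)" if "x \<in> \<Omega>" for x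
      unfolding s_eq using q_eq[OF that] q_pos[OF that]
      by (metis divide_divide_eq_right mult.commute div_by_1)
    moreover have "(\<lambda>x. \<theta> / (1 / p x - \<alpha> / n)) \<in> borel_measurable (lebesgue_on \<Omega>)" by measurable
    ultimately show ?thesis by (subst measurable_cong) auto
  qed
  obtain C\<^sub>0 where C\<^sub>0: "0 \<le> C\<^sub>0" "\<And>g. g \<in> var_lebesgue \<Omega> s \<Longrightarrow>
      var_norm \<Omega> s (hl_maximal \<Omega> g) \<le> ennreal C\<^sub>0 * var_norm \<Omega> s (\<lambda>x. ennreal \<bar>g x\<bar>)"
    using assms(10) by blast
  \<comment> \<open>Adding 1 makes the norm bound for the maximal function of \<open>u\<close>
    strict, and keeps the divisor positive even if \<open>C\<^sub>0 = 0\<close>.\<close>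
  define K where "K = C\<^sub>0 + 1"
  have K: "0 < K" "C\<^sub>0 < K" using C\<^sub>0(1) by (auto simp: K_def)
  \<comment> \<open>Dividing the power \<theta> of the maximal function by \<open>C\<close> amounts
    to dividing the maximal function by \<open>K\<close> before taking the power.\<close>
  define C where "C = K powr \<theta>"
  have C: "0 < C" using K by (simp add: C_def)
  \<comment> \<open>Proved for each admissible \<open>l\<close>; the infimum over \<open>l\<close>
    is taken only at the end.\<close>
  have bound: "var_norm \<Omega> q (frac_maximal \<alpha> \<Omega> f) \<le> ennreal C * ennreal l"
    if f[measurable]: "f \<in> borel_measurable (lebesgue_on \<Omega>)" and l: "0 < l"
      and mod: "var_modular \<Omega> p (\<lambda>x. ennreal \<bar>f x\<bar> / ennreal l) \<le> 1" for f l
  proof -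
    define h where "h = (\<lambda>x. f x / l)"
    \<comment> \<open>The exponent is chosen so that \<open>u x powr s x = v x\<close> on
      \<Omega>.\<close>
    define u where "u = (\<lambda>x. \<bar>h x\<bar> powr (p x / s x))"
    define v where "v = (\<lambda>x. \<bar>h x\<bar> powr p x)"
    have uv_meas: "u \<in> borel_measurable (lebesgue_on \<Omega>)" "v \<in> borel_measurable (lebesgue_on \<Omega>)"
      unfolding u_def v_def h_def by measurable
    have uv_nonneg: "0 \<le> u x" "0 \<le> v x" for x by (auto simp: u_def v_def)
    have mod_v: "(\<integral>\<^sup>+ x\<in>\<Omega>. ennreal (v x) \<partial>lebesgue) \<le> 1"
      using mod l by (simp add: var_modular_def v_def h_def divide_ennreal)
    have "var_modular \<Omega> s (\<lambda>x. ennreal \<bar>u x\<bar> / ennreal 1) = (\<integral>\<^sup>+ x\<in>\<Omega>. ennreal (v x) \<partial>lebesgue)"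
      unfolding var_modular_def using s_pos
      by (intro nn_integral_cong)
        (force simp: u_def v_def powr_powr divide_ennreal_def split: split_indicator)
    with mod_v have mod_u: "var_modular \<Omega> s (\<lambda>x. ennreal \<bar>u x\<bar> / ennreal 1) \<le> 1" by simp
    have "u \<in> var_lebesgue \<Omega> s"
      unfolding var_lebesgue_def
      using uv_meas(1) le_less_trans[OF mod_u ennreal_one_less_top] by (auto intro!: exI[of _ 1])
    then have "var_norm \<Omega> s (hl_maximal \<Omega> u) \<le> ennreal C\<^sub>0 * var_norm \<Omega> s (\<lambda>x. ennreal \<bar>u x\<bar>)"
      by (rule C\<^sub>0(2))
    also have "\<dots> \<le> ennreal C\<^sub>0 * ennreal 1"
      using mod_u by (intro mult_left_mono var_norm_le) auto
    also have "\<dots> < ennreal K"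
      using K C\<^sub>0(1) by (simp add: ennreal_less_iff)
    finally have mod_Mu: "var_modular \<Omega> s (\<lambda>x. hl_maximal \<Omega> u x / ennreal K) \<le> 1"
      using s_pos by (intro var_norm_less_imp_modular_le_1) (auto intro: less_imp_le)
    have "\<bar>h y\<bar> = u y powr (1 - \<alpha> / n) * v y powr (\<alpha> / n)" if y: "y \<in> \<Omega>" for y
    proof -
      \<comment> \<open>The exponents with which |h y| enters through \<open>u\<close> and
        \<open>v\<close> must add up to 1.\<close>
      have "p y / s y * \<theta> + p y * (\<alpha> / n) = p y * (1 / q y + \<alpha> / n)"
        using \<theta> by (simp add: s_eq distrib_left)
      also have "\<dots> = 1"
        using q_eq[OF y] p1[OF y] by simp
      finally show ?thesis
        by (simp add: u_def v_def powr_powr powr_add [symmetric] flip: \<theta>_def)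
    qed
    then have pw: "frac_maximal \<alpha> \<Omega> h x \<le> ennreal_powr (hl_maximal \<Omega> u x) \<theta>" for x
      unfolding \<theta>_def n_def using \<Omega> \<alpha> mod_v uv_meas uv_nonneg
      by (intro frac_maximal_le_hl_maximal_powr[where v = v]) (auto simp: n_def)
    have "var_modular \<Omega> q (\<lambda>x. frac_maximal \<alpha> \<Omega> f x / ennreal (C * l))
        \<le> var_modular \<Omega> s (\<lambda>x. hl_maximal \<Omega> u x / ennreal K)"
    proof (rule var_modular_mono)
      fix x assume x: "x \<in> \<Omega>"
      have "frac_maximal \<alpha> \<Omega> f x / ennreal (C * l) = frac_maximal \<alpha> \<Omega> h x / ennreal C"
        unfolding h_def frac_maximal_divide[OF \<Omega> f l] using C l
        by (cases "frac_maximal \<alpha> \<Omega> f x") (auto simp: divide_ennreal ennreal_top_divide mult_ac)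
      also have "\<dots> \<le> ennreal_powr (hl_maximal \<Omega> u x) \<theta> / ennreal C"
        by (intro divide_right_mono_ennreal pw)
      also have "\<dots> = ennreal_powr (hl_maximal \<Omega> u x / ennreal K) \<theta>"
        using K by (simp add: ennreal_powr_divide C_def)
      finally have "ennreal_powr (frac_maximal \<alpha> \<Omega> f x / ennreal (C * l)) (q x)
          \<le> ennreal_powr (ennreal_powr (hl_maximal \<Omega> u x / ennreal K) \<theta>) (q x)"
        using q_pos[OF x] by (intro ennreal_powr_mono) auto
      then show "ennreal_powr (frac_maximal \<alpha> \<Omega> f x / ennreal (C * l)) (q x)
          \<le> ennreal_powr (hl_maximal \<Omega> u x / ennreal K) (s x)"
        by (simp add: ennreal_powr_powr s_eq mult.commute)
    qed
    with mod_Mu have "var_modular \<Omega> q (\<lambda>x. frac_maximal \<alpha> \<Omega> f x / ennreal (C * l)) \<le> 1" by simp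
    then have "var_norm \<Omega> q (frac_maximal \<alpha> \<Omega> f) \<le> ennreal (C * l)"
      using C l by (intro var_norm_le) auto
    then show ?thesis using C l by (simp add: ennreal_mult)
  qed
  have "var_norm \<Omega> q (frac_maximal \<alpha> \<Omega> f) \<le> ennreal C * var_norm \<Omega> p (\<lambda>x. ennreal \<bar>f x\<bar>)"
    if "f \<in> var_lebesgue \<Omega> p" for f
  proof -
    have f: "f \<in> borel_measurable (lebesgue_on \<Omega>)" using that by (simp add: var_lebesgue_def)
    \<comment> \<open>With \<open>C\<close> moved to the left, the claim is a lower bound for all
      admissible \<open>l\<close>, hence for their infimum. As \<open>C\<close> is positive and
      finite, it can be multiplied back.\<close>
    have "var_norm \<Omega> q (frac_maximal \<alpha> \<Omega> f) / ennreal C \<le> var_norm \<Omega> p (\<lambda>x. ennreal \<bar>f x\<bar>)"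
      unfolding var_norm_def[of \<Omega> p]
    proof (rule Inf_greatest, safe)
      fix l :: real
      assume "0 < l" "var_modular \<Omega> p (\<lambda>x. ennreal \<bar>f x\<bar> / ennreal l) \<le> 1"
      then show "var_norm \<Omega> q (frac_maximal \<alpha> \<Omega> f) / ennreal C \<le> ennreal l"
        using bound[OF f] C by (intro divide_le_posI_ennreal) auto
    qed
    then have "var_norm \<Omega> q (frac_maximal \<alpha> \<Omega> f) / ennreal C * ennreal C
        \<le> var_norm \<Omega> p (\<lambda>x. ennreal \<bar>f x\<bar>) * ennreal C"
      by (intro mult_right_mono) auto
    then show ?thesis
      using C by (simp add: ennreal_divide_times) (simp add: mult.commute)
  qed
  then show ?thesis using C by (intro exI[of _ C]) auto
qed

end
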